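(* Let $T\ge 1$ be an integer, let $\alpha_0,\beta_0:[0,T+1]\to\mathbb{R}$ (discrete interval) with $\alpha_0(t)\le\beta_0(t)$ for all $t\in[0,T+1]$, and put $$D_0=\{(t,y)\in[0,T+1]\times\mathbb{R}:\ \alpha_0(t)\le y\le\beta_0(t)\}.$$ Let $f:D_0\to\mathbb{R}$ be such that $y\mapsto f(t,y)$ is continuous for each $t$, and consider the nonlinear discrete boundary value problem $$(P)\qquad -\Delta^2 y(t-1)=f(t,y(t)),\quad t\in[1,T],\qquad y(0)=0,\quad y(T+1)=0.$$ Assume that $\beta_0$ is an upper solution and $\alpha_0$ is a lower solution of $(P)$. Assume also that there is a constant $M>0$ such that for all $(t,y),(t,w)\in D_0$, $$y\le w\ \Longrightarrow\ f(t,w)-f(t,y)\ge M(w-y).$$ Then: 1. $(P)$ has at least one solution $y$ lying in $D_0$, i.e. with $\alpha_0(t)\le y(t)\le\beta_0(t)$ for all $t\in[0,T+1]$. 2. Let $\lambda$ be any real constant with $\lambda\le M$ and $\lambda<\lambda_1$, where $\lambda_1=2-2\cos\left(\frac{\pi}{T+1}\right)$. Then the sequence $\{\beta_n\}$ generated by the scheme $$-\Delta^2 y_{n+1}(t-1)-\lambda y_{n+1}(t)=f(t,y_n(t))-\lambda y_n(t),\quad t\in[1,T],\qquad y_{n+1}(0)=0,\quad y_{n+1}(T+1)=0,$$ started from $y_0=\beta_0$, is non-increasing and converges uniformly on $[0,T+1]$ to a solution $\widetilde\beta$ of $(P)$. The sequence $\{\alpha_n\}$ generated by the same scheme started from $y_0=\alpha_0$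 is non-decreasing and converges uniformly on $[0,T+1]$ to a solution $\widetilde\alpha$ of $(P)$. 3. Any solution $z$ of $(P)$ in $D_0$ satisfies $\widetilde\alpha(t)\le z(t)\le\widetilde\beta(t)$ for all $t\in[0,T+1]$.
   Context: For integers $a\le b$, $[a,b]$ denotes the discrete interval $\{a,a+1,\dots,b\}$. $\Delta$ is the forward difference operator, $\Delta y(t)=y(t+1)-y(t)$, so $\Delta^2 y(t-1)=y(t+1)-2y(t)+y(t-1)$. A solution of a boundary value problem is a function $y:[0,T+1]\to\mathbb{R}$. A function $y$ lies in $D_0$ if $(t,y(t))\in D_0$ for all $t\in[0,T+1]$. A function $\beta_0:[0,T+1]\to\mathbb{R}$ is an upper solution of $(P)$ if $-\Delta^2\beta_0(t-1)\ge f(t,\beta_0(t))$ for $t\in[1,T]$, $\beta_0(0)=0$ and $\beta_0(T+1)\ge 0$. A function $\alpha_0:[0,T+1]\to\mathbb{R}$ is a lower solution of $(P)$ if $-\Delta^2\alpha_0(t-1)\le f(t,\alpha_0(t))$ for $t\in[1,T]$, $\alpha_0(0)=0$ and $\alpha_0(T+1)\le 0$. The number $\lambda_1=2-2\cos(\pi/(T+1))$ is the first eigenvalue of $\Delta^2y(t-1)+\lambda y(t)=0$ on $[1,T]$, $y(0)=y(T+1)=0$. *)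

theory Defs
  imports "HOL-Analysis.Analysis"
begin

text \<open>
  A function on the discrete interval \<open>[0,T+1]\<close> is represented by a total function
  \<open>nat \<Rightarrow> real\<close> of which only the values on \<open>{0..T+1}\<close> are ever used; likewise a function
  \<open>f\<close> on the sector \<open>D\<^sub>0\<close> is a total curried function which is constrained only on \<open>D\<^sub>0\<close>.
\<close>

definition fwd_diff :: "(nat \<Rightarrow> real) \<Rightarrow> nat \<Rightarrow> real" where
  "fwd_diff y t = y (t + 1) - y t"

text \<open>The value of the second difference at \<open>t - 1\<close> is only used for \<open>t \<ge> 1\<close>.\<close>

abbreviation snd_diff :: "(nat \<Rightarrow> real) \<Rightarrow> nat \<Rightarrow> real" where
  "snd_diff y \<equiv> fwd_diff (fwd_diff y)"

lemma snd_diff_pred: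
  assumes "t \<ge> 1"
  shows "snd_diff y (t - 1) = y (t + 1) - 2 * y t + y (t - 1)"
  using assms by (simp add: fwd_diff_def)

definition sector :: "nat \<Rightarrow> (nat \<Rightarrow> real) \<Rightarrow> (nat \<Rightarrow> real) \<Rightarrow> (nat \<times> real) set" where
  "sector T \<alpha> \<beta> = {(t, y). t \<in> {0..T+1} \<and> \<alpha> t \<le> y \<and> y \<le> \<beta> t}"

definition lies_in :: "nat \<Rightarrow> (nat \<times> real) set \<Rightarrow> (nat \<Rightarrow> real) \<Rightarrow> bool" where
  "lies_in T D y \<longleftrightarrow> (\<forall>t\<in>{0..T+1}. (t, y t) \<in> D)"

definition bvp_solution :: "nat \<Rightarrow> (nat \<Rightarrow> real \<Rightarrow> real) \<Rightarrow> (nat \<Rightarrow> real) \<Rightarrow> bool" where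
  "bvp_solution T f y \<longleftrightarrow>
     (\<forall>t\<in>{1..T}. - snd_diff y (t - 1) = f t (y t)) \<and> y 0 = 0 \<and> y (T + 1) = 0"

definition upper_solution :: "nat \<Rightarrow> (nat \<Rightarrow> real \<Rightarrow> real) \<Rightarrow> (nat \<Rightarrow> real) \<Rightarrow> bool" where
  "upper_solution T f \<beta> \<longleftrightarrow>
     (\<forall>t\<in>{1..T}. - snd_diff \<beta> (t - 1) \<ge> f t (\<beta> t)) \<and> \<beta> 0 = 0 \<and> \<beta> (T + 1) \<ge> 0"

definition lower_solution :: "nat \<Rightarrow> (nat \<Rightarrow> real \<Rightarrow> real) \<Rightarrow> (nat \<Rightarrow> real) \<Rightarrow> bool" where
  "lower_solution T f \<alpha> \<longleftrightarrow>
     (\<forall>t\<in>{1..T}. - snd_diff \<alpha> (t - 1) \<le> f t (\<alpha> t)) \<and> \<alpha> 0 = 0 \<and> \<alpha> (T + 1) \<le> 0"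

definition lambda1 :: "nat \<Rightarrow> real" where
  "lambda1 T = 2 - 2 * cos (pi / (real T + 1))"

text \<open>
  The implicit scheme as a relation: \<open>y\<close> is a sequence starting from \<open>y0\<close> each of whose
  terms solves the linear problem determined by its predecessor. That such a sequence exists,
  is unique on \<open>{0..T+1}\<close> and stays in the sector is not built in.
\<close>

definition scheme_seq ::
  "nat \<Rightarrow> (nat \<Rightarrow> real \<Rightarrow> real) \<Rightarrow> real \<Rightarrow> (nat \<Rightarrow> real) \<Rightarrow> (nat \<Rightarrow> nat \<Rightarrow> real) \<Rightarrow> bool" where
  "scheme_seq T f lam y0 y \<longleftrightarrow>
     (\<forall>t\<in>{0..T+1}. y 0 t = y0 t) \<and>
     (\<forall>n. (\<forall>t\<in>{1..T}. - snd_diff (y (Suc n)) (t - 1) - lam * y (Suc n) t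
                           = f t (y n t) - lam * y n t)
          \<and> y (Suc n) 0 = 0 \<and> y (Suc n) (T + 1) = 0)"

end

theory Submission imports Defs begin

text \<open>
  Since \<open>lam \<le> M\<close>, the function \<open>f(t,y) - lam y\<close> is nondecreasing in \<open>y\<close> on the sector, and
  since \<open>lam < \<lambda>\<^sub>1\<close>, the operator \<open>-\<Delta>\<^sup>2 - lam\<close> with Dirichlet conditions satisfies a
  comparison principle: if a supersolution \<open>u\<close> were negative somewhere, adding the smallest
  multiple of the first eigenfunction \<open>sin (\<pi> t / (T + 1))\<close> that makes it nonnegative would give a
  function violating the inequality at an interior zero. Hence one step of the scheme turns an ordered pair of a
  lower and an upper solution into a tighter pair of the same kind. Bounded monotone iterates
  converge, and by continuity their limits solve the problem. A solution is a fixed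
  point of the scheme, so it is enclosed by comparing the constant sequence with the iterates.
\<close>

section \<open>Linearity of the second difference, and the first eigenpair\<close>

lemma snd_diff_add_scaled:
  assumes "t \<ge> 1"
  shows "snd_diff (\<lambda>s. u s + c * v s) (t - 1) = snd_diff u (t - 1) + c * snd_diff v (t - 1)"
  by (simp add: snd_diff_pred[OF assms] algebra_simps del: One_nat_def)

lemma snd_diff_diff:
  "snd_diff (\<lambda>s. u s - v s) t = snd_diff u t - snd_diff v t"
  by (simp add: fwd_diff_def)

text \<open>The addition formulas give sin(a(t+1)) + sin(a(t-1)) = 2 cos(a) sin(at). With a =
  pi/(T+1) the factor is \<open>lambda1 T\<close>, and the sine vanishes at both ends of the
  interval.\<close>

lemma snd_diff_sin:
  assumes "t \<ge> 1"
  shows "- snd_diff (\<lambda>s. sin (a * real s)) (t - 1) = (2 - 2 * cos a) * sin (a * real t)"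
proof -
  have *: "real (t - 1) = real t - 1" using assms by simp
  show ?thesis
    unfolding snd_diff_pred[OF assms] *
    by (simp add: distrib_left right_diff_distrib sin_add sin_diff algebra_simps)
qed

text \<open>This makes \<open>lam = 0\<close> an admissible parameter of the scheme, which is how
  existence of a solution follows from the iteration.\<close>

lemma lambda1_pos:
  assumes "T \<ge> 1"
  shows "lambda1 T > 0"
proof -
  have "pi / (real T + 1) \<le> pi" by (simp add: divide_le_eq mult_le_cancel_left1)
  then have "cos (pi / (real T + 1)) < cos 0"
    by (intro cos_monotone_0_pi) (auto intro!: divide_pos_pos)
  then show ?thesis by (simp add: lambda1_def)
qed

subsection \<open>The comparison principle\<close>

lemma minimum_principle:
  fixes u :: "nat \<Rightarrow> real"
  assumes lam: "lam < lambda1 T"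
    and u: "\<And>t. t \<in> {1..T} \<Longrightarrow> - snd_diff u (t - 1) - lam * u t \<ge> 0"
    and bd: "u 0 \<ge> 0" "u (T + 1) \<ge> 0"
    and t: "t \<in> {0..T+1}"
  shows "u t \<ge> 0"
proof (rule ccontr)
  assume neg: "\<not> u t \<ge> 0"
  define \<phi> where "\<phi> s = sin (pi / (real T + 1) * real s)" for s
  have \<phi>_pos: "\<phi> s > 0" if "s \<in> {1..T}" for s
  proof -
    have "pi * real s < pi * (real T + 1)" using that by (intro mult_strict_left_mono) auto
    then show ?thesis
      unfolding \<phi>_def using that by (intro sin_gt_zero) (simp_all add: divide_less_eq)
  qed
  have "pi / (real T + 1) * real (T + 1) = pi" by (simp add: add.commute)
  then have \<phi>_bd: "\<phi> 0 = 0" "\<phi> (T + 1) = 0"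
    by (simp_all only: \<phi>_def sin_pi of_nat_0 mult_zero_right sin_zero)
  have \<phi>_eigen: "snd_diff \<phi> (s - 1) = - (lambda1 T * \<phi> s)" if "s \<ge> 1" for s
    using snd_diff_sin[OF that, of "pi / (real T + 1)"] unfolding \<phi>_def lambda1_def by linarith
  have t1: "t \<in> {1..T}"
  proof -
    have "t \<noteq> 0" "t \<noteq> T + 1" using neg bd by metis+
    then show ?thesis using t by auto
  qed
  \<comment> \<open>The critical multiple of \<open>\<phi>\<close> is found by minimising the ratio
    \<open>u / \<phi>\<close> over the interior, where \<open>\<phi>\<close> is positive. At the
    minimiser \<open>m\<close> the function \<open>u + c \<phi>\<close> touches zero.\<close>
  obtain m where m: "m \<in> {1..T}" and min: "\<And>s. s \<in> {1..T} \<Longrightarrow> u m / \<phi> m \<le> u s / \<phi> s"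
    using t1 ex_is_arg_min_if_finite[of "{1..T}" "\<lambda>s. u s / \<phi> s"]
    unfolding is_arg_min_linorder by (metis empty_iff finite_atLeastAtMost)
  define c where "c = - (u m / \<phi> m)"
  have "u t / \<phi> t < 0" using neg \<phi>_pos[OF t1] by (simp add: divide_less_0_iff)
  then have c: "c > 0" using min[OF t1] by (simp add: c_def)
  define v where "v s = u s + c * \<phi> s" for s
  have v_nonneg: "v s \<ge> 0" if "s \<in> {0..T+1}" for s
  proof (cases "s \<in> {1..T}")
    case True
    then show ?thesis using min[OF True] \<phi>_pos[OF True] by (simp add: v_def c_def field_simps)
  next
    case False
    then have "s = 0 \<or> s = T + 1" using that by auto
    then show ?thesis using bd \<phi>_bd by (auto simp: v_def)
  qed
  have vm: "v m = 0" using \<phi>_pos[OF m] by (simp add: v_def c_def)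
  have m1: "m \<ge> 1" using m by simp
  \<comment> \<open>Being an eigenfunction, \<open>\<phi>\<close> contributes the factor
    \<open>lambda1 T - lam\<close>, so the inequality for \<open>v\<close> is strict in the
    interior.\<close>
  have "- snd_diff v (m - 1) - lam * v m
      = (- snd_diff u (m - 1) - lam * u m) + c * ((lambda1 T - lam) * \<phi> m)"
    unfolding v_def snd_diff_add_scaled[OF m1] \<phi>_eigen[OF m1] by (simp add: algebra_simps)
  moreover have "c * ((lambda1 T - lam) * \<phi> m) > 0"
    using c lam \<phi>_pos[OF m] by simp
  ultimately have "- snd_diff v (m - 1) > 0" using u[OF m] vm by simp
  \<comment> \<open>Since \<open>v m = 0\<close>, the second difference at \<open>m\<close> is just
    the sum of the two neighbouring values, both of which lie in the range where \<open>v\<close> is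
    nonnegative.\<close>
  then have "v (m + 1) + v (m - 1) < 0" unfolding snd_diff_pred[OF m1] vm by simp
  moreover have "v (m + 1) \<ge> 0" "v (m - 1) \<ge> 0" using m by (auto intro!: v_nonneg)
  ultimately show False by simp
qed

lemma comparison:
  fixes u v :: "nat \<Rightarrow> real"
  assumes "lam < lambda1 T"
    and "\<And>t. t \<in> {1..T} \<Longrightarrow>
      - snd_diff u (t - 1) - lam * u t \<le> - snd_diff v (t - 1) - lam * v t"
    and "u 0 \<le> v 0" "u (T + 1) \<le> v (T + 1)" "t \<in> {0..T+1}"
  shows "u t \<le> v t"
proof -
  have "- snd_diff (\<lambda>s. v s - u s) (r - 1) - lam * (v r - u r) \<ge> 0" if "r \<in> {1..T}" for r
    using assms(2)[OF that] unfolding snd_diff_diff by (simp add: right_diff_distrib)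
  then have "0 \<le> v t - u t"
    using minimum_principle[OF assms(1), of "\<lambda>s. v s - u s"] assms(3-5) by simp
  then show ?thesis by simp
qed

subsection \<open>The linear problem\<close>

text \<open>Shooting: the linear equation is read as an initial value problem with left value 0 and
  initial slope \<open>s\<close>. The last clause is the equation at \<open>Suc n\<close> solved for
  the next value.\<close>

fun shoot :: "real \<Rightarrow> (nat \<Rightarrow> real) \<Rightarrow> real \<Rightarrow> nat \<Rightarrow> real" where
  "shoot lam h s 0 = 0"
| "shoot lam h s (Suc 0) = s"
| "shoot lam h s (Suc (Suc n)) =
     (2 - lam) * shoot lam h s (Suc n) - shoot lam h s n - h (Suc n)"

lemma shoot_equation:
  assumes "t \<ge> 1"
  shows "- snd_diff (shoot lam h s) (t - 1) - lam * shoot lam h s t = h t"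
proof -
  obtain n where "t = Suc n" using assms by (cases t) auto
  then show ?thesis by (simp add: fwd_diff_def algebra_simps)
qed

text \<open>The recursion is affine in the slope, so the right boundary condition becomes one scalar
  linear equation for \<open>s\<close>.\<close>

lemma shoot_superposition:
  "shoot lam h s n = shoot lam h 0 n + s * shoot lam (\<lambda>_. 0) 1 n"
  by (induction lam h s n rule: shoot.induct) (simp_all add: algebra_simps)

lemma linear_bvp_exists:
  assumes "T \<ge> 1" "lam < lambda1 T"
  obtains y where "\<And>t. t \<in> {1..T} \<Longrightarrow> - snd_diff y (t - 1) - lam * y t = h t"
    and "y 0 = 0" "y (T + 1) = 0"
proof -
  define q where "q = shoot lam (\<lambda>_. 0) 1"
  have q: "- snd_diff q (t - 1) - lam * q t = 0" if "t \<in> {1..T}" for t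
    using that by (simp add: q_def shoot_equation del: One_nat_def)
  have nz: "q (T + 1) \<noteq> 0"
  \<comment> \<open>Otherwise \<open>q\<close> would solve the homogeneous Dirichlet problem, and
    comparison with the zero function would contradict its initial slope 1.\<close>
  proof
    assume "q (T + 1) = 0"
    then have "q 1 \<le> 0"
      using comparison[OF assms(2), of q "\<lambda>_. 0" 1] q assms(1)
      by (simp add: q_def fwd_diff_def del: One_nat_def)
    then show False by (simp add: q_def)
  qed
  \<comment> \<open>The slope is the root of the affine equation expressing that the value at
    \<open>T + 1\<close> vanishes.\<close>
  define y where "y = shoot lam h (- shoot lam h 0 (T + 1) / q (T + 1))"
  have "y (T + 1) = 0"
    using nz unfolding y_def shoot_superposition[of lam h "_ / _"] by (simp add: q_def)
  then show ?thesis
    using that[of y] shoot_equation by (auto simp: y_def simp del: One_nat_def)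
qed

section \<open>Existence and uniqueness of the iterates\<close>

lemma scheme_seq_exists:
  assumes "T \<ge> 1" "lam < lambda1 T"
  obtains y where "scheme_seq T f lam y0 y"
proof -
  define solves where "solves h w \<longleftrightarrow>
    (\<forall>t\<in>{1..T}. - snd_diff w (t - 1) - lam * w t = h t) \<and> w 0 = 0 \<and> w (T + 1) = 0" for h w
  have ex: "\<exists>w. solves h w" for h
    using linear_bvp_exists[OF assms, of h] unfolding solves_def by metis
  \<comment> \<open>The scheme is implicit, so each new term is chosen among the solutions of the
    linear problem set by its predecessor.\<close>
  define y where "y = rec_nat y0 (\<lambda>_ z. SOME w. solves (\<lambda>t. f t (z t) - lam * z t) w)"
  have "solves (\<lambda>t. f t (y n t) - lam * y n t) (y (Suc n))" for n
    using someI_ex[OF ex] by (simp add: y_def)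
  moreover have "y 0 = y0" by (simp add: y_def)
  ultimately have "scheme_seq T f lam y0 y" unfolding scheme_seq_def solves_def by auto
  then show ?thesis by (rule that)
qed

lemma scheme_seq_Suc:
  assumes "scheme_seq T f lam y0 y"
  shows "t \<in> {1..T} \<Longrightarrow>
      - snd_diff (y (Suc n)) (t - 1) - lam * y (Suc n) t = f t (y n t) - lam * y n t"
    and "y (Suc n) 0 = 0" "y (Suc n) (T + 1) = 0"
  using assms unfolding scheme_seq_def by blast+

text \<open>Equal predecessors give equal right-hand sides, and comparison applied in both
  directions forces the next terms to agree.\<close>

lemma scheme_seq_unique:
  assumes "lam < lambda1 T" "scheme_seq T f lam y0 y" "scheme_seq T f lam y0 z" "t \<in> {0..T+1}"
  shows "y n t = z n t"
  using assms(4)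
proof (induction n arbitrary: t)
  case 0
  then show ?case using assms(2,3) by (simp add: scheme_seq_def)
next
  case (Suc n)
  note y = scheme_seq_Suc[OF assms(2), where n = n] and z = scheme_seq_Suc[OF assms(3), where n = n]
  have eq: "- snd_diff (y (Suc n)) (s - 1) - lam * y (Suc n) s
      = - snd_diff (z (Suc n)) (s - 1) - lam * z (Suc n) s" if "s \<in> {1..T}" for s
    using y(1)[OF that] z(1)[OF that] Suc.IH[of s] that by auto
  show ?case
  proof (rule antisym)
    show "y (Suc n) t \<le> z (Suc n) t"
      by (rule comparison[OF assms(1) eq_refl[OF eq] _ _ Suc.prems])
        (simp_all only: y(2,3) z(2,3) order_refl)
    show "z (Suc n) t \<le> y (Suc n) t"
      by (rule comparison[OF assms(1) eq_refl[OF eq[symmetric]] _ _ Suc.prems])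
        (simp_all only: y(2,3) z(2,3) order_refl)
  qed
qed

text \<open>The shift by \<open>lam\<close> occurs on both sides and cancels, so this holds for
  every \<open>lam\<close>.\<close>

lemma scheme_seq_const:
  assumes "bvp_solution T f z"
  shows "scheme_seq T f lam z (\<lambda>_. z)"
  using assms by (auto simp: scheme_seq_def bvp_solution_def)

text \<open>A scheme sequence agrees with its starting function only on \<open>{0..T+1}\<close>.
  This lemma and the two congruences after it transfer properties of the starting function to the
  term of index 0.\<close>

lemma snd_diff_cong:
  assumes "\<And>t. t \<in> {0..T+1} \<Longrightarrow> u t = v t" "t \<in> {1..T}"
  shows "snd_diff u (t - 1) = snd_diff v (t - 1)"
proof -
  have "t \<ge> 1" "u (t + 1) = v (t + 1)" "u t = v t" "u (t - 1) = v (t - 1)"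
    using assms(2) by (auto intro!: assms(1))
  then show ?thesis by (simp only: snd_diff_pred)
qed

lemma lower_solution_cong:
  assumes "\<And>t. t \<in> {0..T+1} \<Longrightarrow> u t = v t"
  shows "lower_solution T f u \<longleftrightarrow> lower_solution T f v"
  using snd_diff_cong[of T u v, OF assms] assms by (auto simp: lower_solution_def simp del: One_nat_def)

lemma upper_solution_cong:
  assumes "\<And>t. t \<in> {0..T+1} \<Longrightarrow> u t = v t"
  shows "upper_solution T f u \<longleftrightarrow> upper_solution T f v"
  using snd_diff_cong[of T u v, OF assms] assms by (auto simp: upper_solution_def simp del: One_nat_def)

lemma lies_in_sector_iff:
  "lies_in T (sector T \<alpha> \<beta>) y \<longleftrightarrow> (\<forall>t\<in>{0..T+1}. \<alpha> t \<le> y t \<and> y t \<le> \<beta> t)"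
  by (auto simp: lies_in_def sector_def)

lemma bvp_solution_imp_lower_upper:
  "bvp_solution T f z \<Longrightarrow> lower_solution T f z \<and> upper_solution T f z"
  by (auto simp: bvp_solution_def lower_solution_def upper_solution_def)

subsection \<open>Monotone iteration\<close>

text \<open>The starting functions \<open>a0\<close> and \<open>b0\<close> are kept separate from
  the ends of the sector, so that either sequence may later be the constant one given by a
  solution.\<close>

lemma scheme_step_bracket:
  fixes T :: nat and \<alpha> \<beta> :: "nat \<Rightarrow> real" and f :: "nat \<Rightarrow> real \<Rightarrow> real"
  defines "D \<equiv> sector T \<alpha> \<beta>"
  assumes lam: "lam < lambda1 T"
    and mono: "\<And>t. mono_on {y. (t, y) \<in> D} (\<lambda>y. f t y - lam * y)"
    and a: "scheme_seq T f lam a0 a" "lower_solution T f (a n)" "lies_in T D (a n)"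
    and b: "scheme_seq T f lam b0 b" "upper_solution T f (b n)" "lies_in T D (b n)"
    and le: "\<forall>t\<in>{0..T+1}. a n t \<le> b n t"
  shows "\<And>t. t \<in> {0..T+1} \<Longrightarrow> a n t \<le> a (Suc n) t"
    and "\<And>t. t \<in> {0..T+1} \<Longrightarrow> b (Suc n) t \<le> b n t"
    and "\<And>t. t \<in> {0..T+1} \<Longrightarrow> a (Suc n) t \<le> b (Suc n) t"
    and "lower_solution T f (a (Suc n))" "upper_solution T f (b (Suc n))"
    and "lies_in T D (a (Suc n))" "lies_in T D (b (Suc n))"
proof -
  note a_eq = scheme_seq_Suc[OF a(1), where n = n] and b_eq = scheme_seq_Suc[OF b(1), where n = n]
  show a_up: "a n t \<le> a (Suc n) t" if "t \<in> {0..T+1}" for t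
    by (rule comparison[OF lam _ _ _ that])
      (use a(2) a_eq in \<open>auto simp: lower_solution_def simp del: One_nat_def\<close>)
  show b_down: "b (Suc n) t \<le> b n t" if "t \<in> {0..T+1}" for t
    by (rule comparison[OF lam _ _ _ that])
      (use b(2) b_eq in \<open>auto simp: upper_solution_def simp del: One_nat_def\<close>)
  have g_le: "f s (a n s) - lam * a n s \<le> f s (b n s) - lam * b n s" if "s \<in> {1..T}" for s
    using that a(3) b(3) le by (intro mono_onD[OF mono]) (auto simp: lies_in_def)
  show ab: "a (Suc n) t \<le> b (Suc n) t" if "t \<in> {0..T+1}" for t
    by (rule comparison[OF lam _ _ _ that])
      (use g_le a_eq b_eq in \<open>auto simp del: One_nat_def\<close>)
  \<comment> \<open>Both new terms are squeezed between \<open>a n\<close> and \<open>b n\<close>.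
    Membership in the sector has to come first, since the monotonicity used below is available only
    there.\<close>
  show a_in: "lies_in T D (a (Suc n))"
    using a(3) b(3) a_up b_down ab unfolding D_def lies_in_sector_iff by (meson order_trans)
  show b_in: "lies_in T D (b (Suc n))"
    using a(3) b(3) a_up b_down ab unfolding D_def lies_in_sector_iff by (meson order_trans)
  \<comment> \<open>Inserted into the scheme, this replaces the old term by the new one on the
    right-hand side, and the \<open>lam\<close> terms cancel. The upper case is symmetric.\<close>
  have "f t (a n t) - lam * a n t \<le> f t (a (Suc n) t) - lam * a (Suc n) t" if "t \<in> {1..T}" for t
    using that a(3) a_in a_up by (intro mono_onD[OF mono]) (auto simp: lies_in_def)
  then show "lower_solution T f (a (Suc n))"
    using a_eq unfolding lower_solution_def by fastforce
  have "f t (b (Suc n) t) - lam * b (Suc n) t \<le> f t (b n t) - lam * b n t" if "t \<in> {1..T}" for t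
    using that b(3) b_in b_down by (intro mono_onD[OF mono]) (auto simp: lies_in_def)
  then show "upper_solution T f (b (Suc n))"
    using b_eq unfolding upper_solution_def by fastforce
qed

lemma scheme_bracket:
  fixes T :: nat and \<alpha> \<beta> :: "nat \<Rightarrow> real" and f :: "nat \<Rightarrow> real \<Rightarrow> real"
  defines "D \<equiv> sector T \<alpha> \<beta>"
  assumes lam: "lam < lambda1 T"
    and mono: "\<And>t. mono_on {y. (t, y) \<in> D} (\<lambda>y. f t y - lam * y)"
    and a: "scheme_seq T f lam a0 a" "lower_solution T f a0" "lies_in T D a0"
    and b: "scheme_seq T f lam b0 b" "upper_solution T f b0" "lies_in T D b0"
    and le: "\<forall>t\<in>{0..T+1}. a0 t \<le> b0 t"
  shows "lies_in T D (a n)" "lies_in T D (b n)"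
    and "t \<in> {0..T+1} \<Longrightarrow> a n t \<le> a (Suc n) t"
    and "t \<in> {0..T+1} \<Longrightarrow> b (Suc n) t \<le> b n t"
    and "t \<in> {0..T+1} \<Longrightarrow> a n t \<le> b n t"
proof -
  have inv: "lower_solution T f (a n) \<and> lies_in T D (a n) \<and>
    upper_solution T f (b n) \<and> lies_in T D (b n) \<and> (\<forall>t\<in>{0..T+1}. a n t \<le> b n t)" for n
  proof (induction n)
    case 0
    have "a 0 t = a0 t" "b 0 t = b0 t" if "t \<in> {0..T+1}" for t
      using a(1) b(1) that by (auto simp: scheme_seq_def)
    then show ?case
      using a b le lower_solution_cong[of T "a 0" a0 f] upper_solution_cong[of T "b 0" b0 f]
      by (auto simp: lies_in_def)
  next
    case (Suc n)
    then have IH: "lower_solution T f (a n)" "lies_in T D (a n)"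
      "upper_solution T f (b n)" "lies_in T D (b n)" "\<forall>t\<in>{0..T+1}. a n t \<le> b n t"
      by blast+
    show ?case
      using scheme_step_bracket(3-7)[OF lam mono[unfolded D_def] a(1) IH(1) IH(2)[unfolded D_def]
          b(1) IH(3) IH(4)[unfolded D_def] IH(5)]
      unfolding D_def by blast
  qed
  then show "lies_in T D (a n)" "lies_in T D (b n)"
    "t \<in> {0..T+1} \<Longrightarrow> a n t \<le> b n t" by blast+
  have inv_n: "lower_solution T f (a n)" "lies_in T D (a n)"
    "upper_solution T f (b n)" "lies_in T D (b n)" "\<forall>t\<in>{0..T+1}. a n t \<le> b n t"
    using inv[of n] by blast+
  show "t \<in> {0..T+1} \<Longrightarrow> a n t \<le> a (Suc n) t" "t \<in> {0..T+1} \<Longrightarrow> b (Suc n) t \<le> b n t"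
    using scheme_step_bracket(1,2)[OF lam mono[unfolded D_def] a(1) inv_n(1)
        inv_n(2)[unfolded D_def] b(1) inv_n(3) inv_n(4)[unfolded D_def] inv_n(5)] by blast+
qed

section \<open>Passage to the limit\<close>

lemma uniform_limit_finite:
  assumes "finite A" "\<And>x. x \<in> A \<Longrightarrow> ((\<lambda>n. f n x) \<longlongrightarrow> g x) F"
  shows "uniform_limit A f g F"
  \<comment> \<open>A finite set is a finite union of singletons, on each of which uniform and
    pointwise convergence coincide.\<close>
  using uniform_limit_on_UNION[of A f "\<lambda>x. {x}" g F] assms by simp

lemma lies_in_sector_limit:
  assumes "\<And>n. lies_in T (sector T \<alpha> \<beta>) (y n)"
    and "\<forall>t\<in>{0..T+1}. (\<lambda>n. y n t) \<longlonglongrightarrow> y' t"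
  shows "lies_in T (sector T \<alpha> \<beta>) y'"
  using assms unfolding lies_in_sector_iff by (meson LIMSEQ_le_const LIMSEQ_le_const2)

text \<open>At each \<open>t\<close> the scheme involves only three values of the new term, so its
  left side converges. The right side converges by continuity of \<open>f t\<close> on its slice of
  the sector, which contains the iterates and, being closed, their limit.\<close>

lemma scheme_limit_solution:
  fixes T :: nat and \<alpha> \<beta> :: "nat \<Rightarrow> real" and f :: "nat \<Rightarrow> real \<Rightarrow> real"
  defines "D \<equiv> sector T \<alpha> \<beta>"
  assumes cont: "\<forall>t\<in>{0..T+1}. continuous_on {y. (t, y) \<in> D} (f t)"
    and y: "scheme_seq T f lam y0 y"
    and y_in: "\<And>n. lies_in T D (y n)"
    and lim: "\<forall>t\<in>{0..T+1}. (\<lambda>n. y n t) \<longlonglongrightarrow> y' t"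
  shows "bvp_solution T f y'"
proof -
  have y'_in: "lies_in T D y'"
    using lies_in_sector_limit[OF y_in[unfolded D_def] lim] by (simp add: D_def)
  have "- snd_diff y' (t - 1) = f t (y' t)" if t: "t \<in> {1..T}" for t
  proof -
    have t1: "t \<ge> 1" and mem: "t \<in> {0..T+1}" "t + 1 \<in> {0..T+1}" "t - 1 \<in> {0..T+1}"
      using t by auto
    have "(\<lambda>n. - snd_diff (y (Suc n)) (t - 1) - lam * y (Suc n) t)
        \<longlonglongrightarrow> - snd_diff y' (t - 1) - lam * y' t"
      unfolding snd_diff_pred[OF t1] by (intro tendsto_intros LIMSEQ_Suc lim[rule_format] mem)
    moreover have "(\<lambda>n. f t (y n t)) \<longlonglongrightarrow> f t (y' t)"
      by (rule continuous_on_tendsto_compose[OF bspec[OF cont mem(1)] bspec[OF lim mem(1)]])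
        (use y_in y'_in mem(1) in \<open>auto simp: lies_in_def\<close>)
    then have "(\<lambda>n. f t (y n t) - lam * y n t) \<longlonglongrightarrow> f t (y' t) - lam * y' t"
      by (intro tendsto_intros lim[rule_format] mem)
    ultimately have "- snd_diff y' (t - 1) - lam * y' t = f t (y' t) - lam * y' t"
      using LIMSEQ_unique unfolding scheme_seq_Suc(1)[OF y t] by blast
    then show ?thesis by simp
  qed
  \<comment> \<open>Zero boundary values are guaranteed only from index 1 on, since the starting
    function may be nonzero at \<open>T + 1\<close>; hence the shifted sequence.\<close>
  moreover have "y' s = 0" if "s = 0 \<or> s = T + 1" for s
  proof (rule LIMSEQ_unique)
    show "(\<lambda>n. y (Suc n) s) \<longlonglongrightarrow> y' s" using that by (intro LIMSEQ_Suc lim[rule_format]) auto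
    show "(\<lambda>n. y (Suc n) s) \<longlonglongrightarrow> 0" using scheme_seq_Suc(2,3)[OF y] that by auto
  qed
  ultimately show ?thesis by (simp add: bvp_solution_def)
qed

theorem theorem4p1:
  fixes T :: nat and \<alpha>0 \<beta>0 :: "nat \<Rightarrow> real" and f :: "nat \<Rightarrow> real \<Rightarrow> real" and M :: real
  defines "D0 \<equiv> sector T \<alpha>0 \<beta>0"
  assumes "T \<ge> 1"
    and "\<And>t. t \<in> {0..T+1} \<Longrightarrow> \<alpha>0 t \<le> \<beta>0 t"
    and "\<And>t. t \<in> {0..T+1} \<Longrightarrow> continuous_on {y. (t, y) \<in> D0} (f t)"
    and "upper_solution T f \<beta>0"
    and "lower_solution T f \<alpha>0"
    and "M > 0"
    and "\<And>t y w. (t, y) \<in> D0 \<Longrightarrow> (t, w) \<in> D0 \<Longrightarrow> y \<le> w \<Longrightarrow> f t w - f t y \<ge> M * (w - y)"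
  shows "(\<exists>y. bvp_solution T f y \<and> lies_in T D0 y) \<and>
    (\<forall>lam. lam \<le> M \<and> lam < lambda1 T \<longrightarrow>
      (\<exists>\<beta> \<alpha> \<beta>' \<alpha>'.
        scheme_seq T f lam \<beta>0 \<beta> \<and>
        (\<forall>b. scheme_seq T f lam \<beta>0 b \<longrightarrow> (\<forall>n. \<forall>t\<in>{0..T+1}. b n t = \<beta> n t)) \<and>
        (\<forall>n. lies_in T D0 (\<beta> n)) \<and>
        (\<forall>t\<in>{0..T+1}. decseq (\<lambda>n. \<beta> n t)) \<and>
        uniform_limit {0..T+1} \<beta> \<beta>' sequentially \<and>
        bvp_solution T f \<beta>' \<and> lies_in T D0 \<beta>' \<and>
        scheme_seq T f lam \<alpha>0 \<alpha> \<and>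
        (\<forall>a. scheme_seq T f lam \<alpha>0 a \<longrightarrow> (\<forall>n. \<forall>t\<in>{0..T+1}. a n t = \<alpha> n t)) \<and>
        (\<forall>n. lies_in T D0 (\<alpha> n)) \<and>
        (\<forall>t\<in>{0..T+1}. incseq (\<lambda>n. \<alpha> n t)) \<and>
        uniform_limit {0..T+1} \<alpha> \<alpha>' sequentially \<and>
        bvp_solution T f \<alpha>' \<and> lies_in T D0 \<alpha>' \<and>
        (\<forall>z. bvp_solution T f z \<and> lies_in T D0 z \<longrightarrow>
          (\<forall>t\<in>{0..T+1}. \<alpha>' t \<le> z t \<and> z t \<le> \<beta>' t))))"
proof -
  have lower: "lower_solution T f \<alpha>0" and upper: "upper_solution T f \<beta>0" by fact+
  have ends_in: "lies_in T D0 \<alpha>0" "lies_in T D0 \<beta>0"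
    using assms(3) by (auto simp: D0_def lies_in_sector_iff)
  have order: "\<forall>t\<in>{0..T+1}. \<alpha>0 t \<le> \<beta>0 t" using assms(3) by blast
  have main: "\<exists>\<beta> \<alpha> \<beta>' \<alpha>'.
        scheme_seq T f lam \<beta>0 \<beta> \<and>
        (\<forall>b. scheme_seq T f lam \<beta>0 b \<longrightarrow> (\<forall>n. \<forall>t\<in>{0..T+1}. b n t = \<beta> n t)) \<and>
        (\<forall>n. lies_in T D0 (\<beta> n)) \<and>
        (\<forall>t\<in>{0..T+1}. decseq (\<lambda>n. \<beta> n t)) \<and>
        uniform_limit {0..T+1} \<beta> \<beta>' sequentially \<and>
        bvp_solution T f \<beta>' \<and> lies_in T D0 \<beta>' \<and>
        scheme_seq T f lam \<alpha>0 \<alpha> \<and>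
        (\<forall>a. scheme_seq T f lam \<alpha>0 a \<longrightarrow> (\<forall>n. \<forall>t\<in>{0..T+1}. a n t = \<alpha> n t)) \<and>
        (\<forall>n. lies_in T D0 (\<alpha> n)) \<and>
        (\<forall>t\<in>{0..T+1}. incseq (\<lambda>n. \<alpha> n t)) \<and>
        uniform_limit {0..T+1} \<alpha> \<alpha>' sequentially \<and>
        bvp_solution T f \<alpha>' \<and> lies_in T D0 \<alpha>' \<and>
        (\<forall>z. bvp_solution T f z \<and> lies_in T D0 z \<longrightarrow>
          (\<forall>t\<in>{0..T+1}. \<alpha>' t \<le> z t \<and> z t \<le> \<beta>' t))"
    if "lam \<le> M" and lam: "lam < lambda1 T" for lam
  proof -
    have mono: "mono_on {y. (t, y) \<in> D0} (\<lambda>y. f t y - lam * y)" for t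
    proof (rule mono_onI)
      fix y w
      assume yw: "y \<in> {y. (t, y) \<in> D0}" "w \<in> {y. (t, y) \<in> D0}" "y \<le> w"
      have "lam * (w - y) \<le> M * (w - y)"
        using \<open>lam \<le> M\<close> yw(3) by (intro mult_right_mono) auto
      also have "\<dots> \<le> f t w - f t y" using assms(8) yw by simp
      finally show "f t y - lam * y \<le> f t w - lam * w" by (simp add: right_diff_distrib)
    qed
    \<comment> \<open>Left general in the two sequences because three pairs are compared: the two
      iterations with each other, and each of them with a constant sequence.\<close>
    note bracket = scheme_bracket[where \<alpha> = \<alpha>0 and \<beta> = \<beta>0, OF lam,
        folded D0_def, where f = f, OF mono]
    obtain \<alpha> where \<alpha>: "scheme_seq T f lam \<alpha>0 \<alpha>" using scheme_seq_exists[OF assms(2) lam] .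
    obtain \<beta> where \<beta>: "scheme_seq T f lam \<beta>0 \<beta>" using scheme_seq_exists[OF assms(2) lam] .
    note ab = bracket[OF \<alpha> lower ends_in(1) \<beta> upper ends_in(2) order]
    have inc: "incseq (\<lambda>n. \<alpha> n t)" and dec: "decseq (\<lambda>n. \<beta> n t)" if "t \<in> {0..T+1}" for t
      using ab(3,4) that by (auto intro!: incseq_SucI decseq_SucI)
    \<comment> \<open>A monotone sequence needs a bound only on the side towards which it moves, and
      the opposite end of the sector supplies it.\<close>
    have bounds: "\<alpha> n t \<le> \<beta>0 t" "\<alpha>0 t \<le> \<beta> n t" if "t \<in> {0..T+1}" for n t
      using ab(1,2)[of n] that by (auto simp: D0_def lies_in_sector_iff)
    have "\<exists>l. (\<lambda>n. \<alpha> n t) \<longlonglongrightarrow> l" if "t \<in> {0..T+1}" for t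
      using incseq_convergent[OF inc[OF that]] bounds(1)[OF that] by metis
    then obtain \<alpha>' where lim_\<alpha>: "\<forall>t\<in>{0..T+1}. (\<lambda>n. \<alpha> n t) \<longlonglongrightarrow> \<alpha>' t"
      by metis
    have "\<exists>l. (\<lambda>n. \<beta> n t) \<longlonglongrightarrow> l" if "t \<in> {0..T+1}" for t
      using decseq_convergent[OF dec[OF that]] bounds(2)[OF that] by metis
    then obtain \<beta>' where lim_\<beta>: "\<forall>t\<in>{0..T+1}. (\<lambda>n. \<beta> n t) \<longlonglongrightarrow> \<beta>' t"
      by metis
    have enclosed: "\<alpha>' t \<le> z t \<and> z t \<le> \<beta>' t"
      if z: "bvp_solution T f z" "lies_in T D0 z" and t: "t \<in> {0..T+1}" for z t
    proof -
      have z': "\<forall>s\<in>{0..T+1}. \<alpha>0 s \<le> z s" "\<forall>s\<in>{0..T+1}. z s \<le> \<beta>0 s"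
        using z(2) by (auto simp: D0_def lies_in_sector_iff)
      have z_lu: "lower_solution T f z" "upper_solution T f z"
        using bvp_solution_imp_lower_upper[OF z(1)] by auto
      \<comment> \<open>Here \<open>z\<close> plays the upper sequence against the iterates from
        \<open>\<alpha>0\<close>; next it plays the lower one against those from
        \<open>\<beta>0\<close>.\<close>
      have "\<alpha> n t \<le> z t" for n
        using bracket(5)[OF \<alpha> lower ends_in(1) scheme_seq_const[OF z(1)] z_lu(2) z(2) z'(1) t] .
      moreover have "z t \<le> \<beta> n t" for n
        using bracket(5)[OF scheme_seq_const[OF z(1)] z_lu(1) z(2) \<beta> upper ends_in(2) z'(2) t] .
      ultimately show ?thesis
        using bspec[OF lim_\<alpha> t] bspec[OF lim_\<beta> t] by (meson LIMSEQ_le_const LIMSEQ_le_const2)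
    qed
    have cont: "\<forall>t\<in>{0..T+1}. continuous_on {y. (t, y) \<in> D0} (f t)" using assms(4) by blast
    have "bvp_solution T f \<alpha>'" "bvp_solution T f \<beta>'"
      using scheme_limit_solution[OF cont[unfolded D0_def]] \<alpha> \<beta> ab(1,2) lim_\<alpha> lim_\<beta>
      unfolding D0_def by blast+
    moreover have "lies_in T D0 \<alpha>'" "lies_in T D0 \<beta>'"
      using lies_in_sector_limit[OF ab(1)[unfolded D0_def] lim_\<alpha>]
        lies_in_sector_limit[OF ab(2)[unfolded D0_def] lim_\<beta>] by (simp_all add: D0_def)
    moreover have "uniform_limit {0..T+1} \<alpha> \<alpha>' sequentially"
      "uniform_limit {0..T+1} \<beta> \<beta>' sequentially"
      using lim_\<alpha> lim_\<beta> by (auto intro!: uniform_limit_finite)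
    moreover have "\<forall>n. lies_in T D0 (\<alpha> n)" "\<forall>n. lies_in T D0 (\<beta> n)"
      "\<forall>t\<in>{0..T+1}. incseq (\<lambda>n. \<alpha> n t)" "\<forall>t\<in>{0..T+1}. decseq (\<lambda>n. \<beta> n t)"
      using ab(1,2) inc dec by blast+
    moreover have "\<forall>a. scheme_seq T f lam \<alpha>0 a \<longrightarrow> (\<forall>n. \<forall>t\<in>{0..T+1}. a n t = \<alpha> n t)"
      "\<forall>b. scheme_seq T f lam \<beta>0 b \<longrightarrow> (\<forall>n. \<forall>t\<in>{0..T+1}. b n t = \<beta> n t)"
      using scheme_seq_unique[OF lam _ \<alpha>] scheme_seq_unique[OF lam _ \<beta>] by blast+
    moreover have "\<forall>z. bvp_solution T f z \<and> lies_in T D0 z \<longrightarrow>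
        (\<forall>t\<in>{0..T+1}. \<alpha>' t \<le> z t \<and> z t \<le> \<beta>' t)"
      using enclosed by blast
    moreover note \<alpha> \<beta>
    ultimately show ?thesis
      by (intro exI[of _ \<beta>] exI[of _ \<alpha>] exI[of _ \<beta>'] exI[of _ \<alpha>'] conjI) assumption+
  qed
  \<comment> \<open>Existence is read off from the iteration with \<open>lam = 0\<close>, which lies
    below both \<open>M\<close> and \<open>lambda1 T\<close>.\<close>
  have "0 \<le> M" using assms(7) by simp
  then have "\<exists>y. bvp_solution T f y \<and> lies_in T D0 y"
    using main[OF _ lambda1_pos[OF assms(2)]] by blast
  with main show ?thesis by blast
qed

end
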